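(* Let $n\ge 6$. Among all cycle barbells $CB(k,a,b)$ (with integers $a,b\ge3$, $k\ge2$) having exactly $n$ vertices, the edge Kemeny's constant $\mathscr{K}_e$ is maximized by $CB(n-4,3,3)$, i.e. when $a=b=3$ and the path contains all remaining vertices. Moreover, \[ \mathscr{K}_e(CB(n-4,3,3))=\frac{2n^3+12n^2-51n+101}{6(n+1)}. \]
   Context: The cycle barbell $CB(k,a,b)$ is the graph obtained from a cycle $C_a$, a path $P_k$ on $k$ vertices and a cycle $C_b$ by identifying one endpoint of the path with a vertex of $C_a$ and the other endpoint with a vertex of $C_b$. It has $a+b+k-2$ vertices and $a+b+k-1$ edges. Kemeny's constant of an irreducible finite Markov chain with transition matrix $P$ whose eigenvalues (with multiplicity) are $1=\rho_1,\rho_2,\dots,\rho_N$ (with $1$ simple) is $\mathscr{K}(P)=\sum_{i=2}^{N}\frac{1}{1-\rho_i}$. $\mathscr{K}_e(G)$ is Kemeny's constant of the simple random walk on the arcs of $G$ (ordered pairs $(u,v)$ with $\{u,v\}$ an edge), where from $(u,v)$ one moves to $(v,w)$ with probability $1/\deg(v)$ for each neighbor $w$ of $v$. *)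

theory Defs
  imports "Jordan_Normal_Form.Char_Poly" "HOL-Library.Product_Lexorder"
begin

(* Kemeny's constant: sum over the eigenvalues rho (with multiplicity) different
   from 1 of 1/(1-rho).  Eigenvalues = roots of the characteristic polynomial over C,
   multiplicity = root order.  (Under the standing assumption that 1 is a simple
   eigenvalue, this is exactly sum_{i=2}^N 1/(1-rho_i).) *)
definition kemeny :: "complex mat \<Rightarrow> complex" where
  "kemeny P = (\<Sum>\<rho> \<in> {\<rho>. poly (char_poly P) \<rho> = 0} - {1}.
                 of_nat (order \<rho> (char_poly P)) / (1 - \<rho>))"

(* graph given by a vertex set V and a symmetric adjacency relation adj *)
definition gdeg :: "('a \<Rightarrow> 'a \<Rightarrow> bool) \<Rightarrow> 'a set \<Rightarrow> 'a \<Rightarrow> nat" where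
  "gdeg adj V v = card {w \<in> V. adj v w}"

definition arcs :: "('a \<Rightarrow> 'a \<Rightarrow> bool) \<Rightarrow> 'a set \<Rightarrow> ('a \<times> 'a) set" where
  "arcs adj V = {(u, v). u \<in> V \<and> v \<in> V \<and> adj u v}"

definition arc_walk_matrix :: "('a::linorder \<Rightarrow> 'a \<Rightarrow> bool) \<Rightarrow> 'a set \<Rightarrow> complex mat" where
  "arc_walk_matrix adj V =
    (let A = sorted_list_of_set (arcs adj V) in
     mat (length A) (length A)
       (\<lambda>(i, j). if snd (A ! i) = fst (A ! j)
                 then 1 / of_nat (gdeg adj V (snd (A ! i))) else 0))"

definition edge_kemeny :: "('a::linorder \<Rightarrow> 'a \<Rightarrow> bool) \<Rightarrow> 'a set \<Rightarrow> complex" where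
  "edge_kemeny adj V = kemeny (arc_walk_matrix adj V)"

(* Cycle barbell CB(k,a,b) on vertices {0..<a+b+k-2}:
   cycle C_a on 0..a-1; path P_k = p_0,...,p_(k-1) with p_0 = 0, p_j = a+j-1 (j>=1);
   cycle C_b on a+k-2 .. a+k+b-3 (so p_(k-1) = a+k-2 is on C_b). *)
definition cb_verts :: "nat \<Rightarrow> nat \<Rightarrow> nat \<Rightarrow> nat set" where
  "cb_verts k a b = {0..<a + b + k - 2}"

definition cb_pathv :: "nat \<Rightarrow> nat \<Rightarrow> nat" where
  "cb_pathv a j = (if j = 0 then 0 else a + j - 1)"

definition cb_edge :: "nat \<Rightarrow> nat \<Rightarrow> nat \<Rightarrow> nat \<Rightarrow> nat \<Rightarrow> bool" where
  "cb_edge k a b u v \<longleftrightarrow>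
     (\<exists>i<a. u = i \<and> v = (i + 1) mod a)
   \<or> (\<exists>j. j + 1 < k \<and> u = cb_pathv a j \<and> v = cb_pathv a (j + 1))
   \<or> (\<exists>i<b. u = a + k - 2 + i \<and> v = a + k - 2 + (i + 1) mod b)"

definition cb_adj :: "nat \<Rightarrow> nat \<Rightarrow> nat \<Rightarrow> nat \<Rightarrow> nat \<Rightarrow> bool" where
  "cb_adj k a b u v \<longleftrightarrow> cb_edge k a b u v \<or> cb_edge k a b v u"

definition Ke_CB :: "nat \<Rightarrow> nat \<Rightarrow> nat \<Rightarrow> complex" where
  "Ke_CB k a b = edge_kemeny (cb_adj k a b) (cb_verts k a b)"

end

theory Submission
  imports Defs "Jordan_Normal_Form.Schur_Decomposition"
begin

text \<open>
  The arc walk factors as a product of an arc-by-vertex and a vertex-by-arc matrix whose product in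
  the other order is the vertex walk. By Sylvester's determinant identity the two walks have the
  same nonzero eigenvalues, so their Kemeny constants differ by the number of arcs minus the number
  of vertices. Kemeny's constant of the vertex walk is the trace of a fundamental matrix minus one,
  and the effective resistances \<open>R\<close> give such a matrix explicitly: with the degrees \<open>d\<close> and
  their sum \<open>N\<close>, it evaluates to \<open>(\<Sum>u v. d u * d v * R u v) / (2 * N)\<close>.

  On a cycle barbell, \<open>R\<close> is the sum of the resistances of the two cycles and of the path between
  the images under the retractions. With \<open>m\<close> edges in total, the double sum is
  \<open>(4 * m ^ 3 + 2 * m) / 3\<close>, its value on a path with \<open>m\<close> edges, minus a penalty for each
  cycle; the penalty of a cycle is smallest for a triangle.
\<close>

section \<open>Eigenvalues as multisets of polynomial roots\<close>

definition mat_trace :: "'a :: comm_monoid_add mat \<Rightarrow> 'a" where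
  "mat_trace A = (\<Sum>i<dim_row A. A $$ (i, i))"

lemma mat_trace_mult_commute:
  fixes A B :: "'a :: comm_semiring_0 mat"
  assumes "A \<in> carrier_mat n m" "B \<in> carrier_mat m n"
  shows "mat_trace (A * B) = mat_trace (B * A)"
proof -
  have "mat_trace (A * B) = (\<Sum>i<n. \<Sum>j<m. A $$ (i, j) * B $$ (j, i))"
    using assms by (auto simp: mat_trace_def scalar_prod_def atLeast0LessThan intro!: sum.cong)
  also have "\<dots> = (\<Sum>j<m. \<Sum>i<n. B $$ (j, i) * A $$ (i, j))"
    by (subst sum.swap) (simp add: mult.commute)
  also have "\<dots> = mat_trace (B * A)"
    using assms by (auto simp: mat_trace_def scalar_prod_def atLeast0LessThan intro!: sum.cong)
  finally show ?thesis .
qed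

lemma mat_trace_similar:
  fixes A B :: "'a :: comm_ring_1 mat"
  assumes "similar_mat A B"
  shows "mat_trace A = mat_trace B"
proof -
  obtain n P Q where A: "A \<in> carrier_mat n n" and wit: "similar_mat_wit A B P Q"
    using assms by (auto simp: similar_mat_def similar_mat_wit_def Let_def)
  note sim = similar_mat_witD2[OF A wit]
  have "mat_trace A = mat_trace (Q * (P * B))"
    unfolding sim(3) using sim(4-7) by (intro mat_trace_mult_commute) auto
  also have "Q * (P * B) = Q * P * B"
    using sim(5-7) by (simp add: assoc_mult_mat)
  also have "\<dots> = B"
    using sim(2,5) by simp
  finally show ?thesis .
qed

lemma proots_prod_linear_factors:
  fixes M :: "'a :: idom multiset"
  shows "proots (\<Prod>e\<in>#M. [:- e, 1:]) = M"
proof (induction M)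
  case (add e M)
  have "(\<Prod>e\<in>#M. [:- e, 1:]) \<noteq> 0"
    by (auto simp: prod_mset_zero_iff)
  with add show ?case
    by (simp add: proots_mult del: mult_pCons_left)
qed simp

lemma poly_prod_linear_factors:
  fixes M :: "'a :: idom multiset"
  shows "poly (\<Prod>e\<in>#M. [:- e, 1:]) x = (\<Prod>e\<in>#M. x - e)"
  by (simp add: poly_prod_mset image_mset.compositionality o_def)

lemma proots_eqI:
  fixes p :: "'a :: {idom, ring_char_0} poly"
  assumes "\<And>x. poly p x = (\<Prod>e\<in>#M. x - e)"
  shows "proots p = M"
proof -
  have "poly p = poly (\<Prod>e\<in>#M. [:- e, 1:])"
    unfolding poly_prod_linear_factors using assms by (rule ext)
  then have "p = (\<Prod>e\<in>#M. [:- e, 1:])"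
    by (simp only: poly_eq_poly_eq_iff)
  then show ?thesis
    by (simp only: proots_prod_linear_factors)
qed

lemma char_poly_nonzero:
  fixes A :: "'a :: comm_ring_1 mat"
  assumes "A \<in> carrier_mat n n"
  shows "char_poly A \<noteq> 0"
  using degree_monic_char_poly[OF assms] by auto

lemma poly_char_poly_eq_prod_proots:
  fixes A :: "complex mat"
  assumes "A \<in> carrier_mat n n"
  shows "poly (char_poly A) x = (\<Prod>e\<in>#proots (char_poly A). x - e)"
proof -
  have "char_poly A = (\<Prod>e\<in>#proots (char_poly A). [:- e, 1:])"
    using complex_poly_decompose_multiset[of "char_poly A"] degree_monic_char_poly[OF assms]
    by simp
  then show ?thesis
    by (metis poly_prod_linear_factors)
qed

lemma mat_trace_eq_sum_proots:
  fixes A :: "complex mat"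
  assumes A: "A \<in> carrier_mat n n"
  shows "mat_trace A = (\<Sum>e\<in>#proots (char_poly A). e)"
proof -
  obtain es where "char_poly A = (\<Prod>e\<leftarrow>es. [:- e, 1:])"
    using char_poly_factorized[OF A] by blast
  then obtain B where B: "B \<in> carrier_mat n n" "upper_triangular B" "similar_mat A B"
    using schur_decomposition_exists[OF A] by blast
  have "char_poly A = (\<Prod>e\<in>#mset (diag_mat B). [:- e, 1:])"
    using char_poly_similar[OF B(3)] char_poly_upper_triangular[OF B(1,2)]
    by (simp add: prod_mset_prod_list flip: mset_map)
  then have "(\<Sum>e\<in>#proots (char_poly A). e) = sum_list (diag_mat B)"
    by (simp add: proots_prod_linear_factors sum_mset_sum_list)
  also have "\<dots> = mat_trace B"
    by (simp add: diag_mat_def mat_trace_def interv_sum_list_conv_sum_set_nat atLeast0LessThan)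
  finally show ?thesis
    using mat_trace_similar[OF B(3)] by simp
qed

lemma poly_char_poly_eq_det:
  fixes A :: "'a :: field mat"
  assumes "A \<in> carrier_mat n n"
  shows "poly (char_poly A) x = det (x \<cdot>\<^sub>m 1\<^sub>m n - A)"
proof -
  have "- char_matrix A x = x \<cdot>\<^sub>m 1\<^sub>m n - A"
    using assms by (intro eq_matI) (auto simp: char_matrix_def)
  then show ?thesis
    using char_poly_matrix[OF assms] by simp
qed

text \<open>Both determinants arise from eliminating a block of
  \<open>[[y 1, -A], [B, 1]]\<close> on the right, respectively on the left.\<close>

lemma det_smult_one_add_mult_commute:
  fixes A B :: "'a :: idom mat"
  assumes A: "A \<in> carrier_mat n m" and B: "B \<in> carrier_mat m n"
  shows "y ^ m * det (y \<cdot>\<^sub>m 1\<^sub>m n + A * B) = y ^ n * det (y \<cdot>\<^sub>m 1\<^sub>m m + B * A)"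
proof -
  let ?block = "four_block_mat (y \<cdot>\<^sub>m 1\<^sub>m n) (- A) B (1\<^sub>m m)"
  let ?right = "four_block_mat (1\<^sub>m n) (0\<^sub>m n m) (- B) (1\<^sub>m m)"
  let ?left = "four_block_mat (1\<^sub>m n) (0\<^sub>m n m) (- B) (y \<cdot>\<^sub>m 1\<^sub>m m)"
  have block: "?block \<in> carrier_mat (n + m) (n + m)"
    using four_block_carrier_mat[of _ n n _ m m] by simp
  have right: "?right \<in> carrier_mat (n + m) (n + m)" and left: "?left \<in> carrier_mat (n + m) (n + m)"
    using four_block_carrier_mat[of _ n n _ m m] by auto
  have "?block * ?right = four_block_mat (y \<cdot>\<^sub>m 1\<^sub>m n + A * B) (- A) (0\<^sub>m m n) (1\<^sub>m m)"
    using A B by (subst mult_four_block_mat[of _ n n _ m _ m]) auto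
  then have "det ?block * det ?right = det (y \<cdot>\<^sub>m 1\<^sub>m n + A * B)"
    using A B by (simp add: det_four_block_mat_lower_left_zero[of _ n]
        flip: det_mult[OF block right])
  then have right_eq: "det ?block = det (y \<cdot>\<^sub>m 1\<^sub>m n + A * B)"
    using B by (simp add: det_four_block_mat_upper_right_zero[of _ n _ m])
  have "?left * ?block = four_block_mat (y \<cdot>\<^sub>m 1\<^sub>m n) (- A) (0\<^sub>m m n) (y \<cdot>\<^sub>m 1\<^sub>m m + B * A)"
    using A B by (subst mult_four_block_mat[of _ n n _ m _ m]) (auto simp: comm_add_mat[of _ m m])
  then have "det ?left * det ?block = y ^ n * det (y \<cdot>\<^sub>m 1\<^sub>m m + B * A)"
    using A B by (simp add: det_four_block_mat_lower_left_zero[of _ n _ m]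
        flip: det_mult[OF left block])
  then have "y ^ m * det ?block = y ^ n * det (y \<cdot>\<^sub>m 1\<^sub>m m + B * A)"
    using B by (simp add: det_four_block_mat_upper_right_zero[of _ n _ m])
  then show ?thesis
    by (simp add: right_eq)
qed

lemma proots_char_poly_mult_commute:
  fixes A B :: "complex mat"
  assumes A: "A \<in> carrier_mat n m" and B: "B \<in> carrier_mat m n"
  shows "proots (char_poly (A * B)) + replicate_mset m 0
    = proots (char_poly (B * A)) + replicate_mset n 0"
proof -
  have minus_mult: "x \<cdot>\<^sub>m 1\<^sub>m k - C * D = x \<cdot>\<^sub>m 1\<^sub>m k + C * (- D)"
    "x \<cdot>\<^sub>m 1\<^sub>m k - C * D = x \<cdot>\<^sub>m 1\<^sub>m k + (- C) * D"
    if "C \<in> carrier_mat k l" "D \<in> carrier_mat l k" for x :: complex and C D :: "complex mat" and k l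
    using that by (auto intro!: eq_matI)
  have "poly ([:0, 1:] ^ m * char_poly (A * B)) x = poly ([:0, 1:] ^ n * char_poly (B * A)) x" for x
    using det_smult_one_add_mult_commute[OF A uminus_carrier_mat[OF B], of x] A B
    by (simp add: poly_char_poly_eq_det[of _ n] poly_char_poly_eq_det[of _ m] minus_mult(1)[OF A B]
        minus_mult(2)[OF B A])
  then have "[:0, 1:] ^ m * char_poly (A * B) = [:0, 1:] ^ n * char_poly (B * A)"
    by (simp add: poly_eq_poly_eq_iff[symmetric] fun_eq_iff)
  from arg_cong[OF this, of proots] show ?thesis
    using char_poly_nonzero[of "A * B" n] char_poly_nonzero[of "B * A" m] A B
    by (simp add: proots_mult proots_power add.commute)
qed

lemma smult_one_mat: "(1 :: 'a :: monoid_mult) \<cdot>\<^sub>m A = A"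
  by (rule eq_matI) auto

lemma det_smult_one_add_rank_one:
  fixes u w :: "'a :: idom mat"
  assumes u: "u \<in> carrier_mat n 1" and w: "w \<in> carrier_mat 1 n"
    and pairing: "w * u = \<mu> \<cdot>\<^sub>m 1\<^sub>m 1"
  shows "y * det (y \<cdot>\<^sub>m 1\<^sub>m n + u * w) = y ^ n * (y + \<mu>)"
proof -
  have "det (y \<cdot>\<^sub>m 1\<^sub>m 1 + w * u) = y + \<mu>"
    unfolding pairing by (subst det_single) auto
  then show ?thesis
    using det_smult_one_add_mult_commute[OF u w, of y] by simp
qed

lemma rank_one_shift_factorization:
  fixes A u w :: "'a :: comm_ring_1 mat"
  assumes A: "A \<in> carrier_mat n n" and u: "u \<in> carrier_mat n 1" and w: "w \<in> carrier_mat 1 n"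
    and eigen: "A * u = \<kappa> \<cdot>\<^sub>m u"
  shows "(x \<cdot>\<^sub>m 1\<^sub>m n - A) * ((x - \<kappa>) \<cdot>\<^sub>m 1\<^sub>m n + u * w)
    = (x - \<kappa>) \<cdot>\<^sub>m (x \<cdot>\<^sub>m 1\<^sub>m n - (A - u * w))"
proof -
  let ?X = "x \<cdot>\<^sub>m 1\<^sub>m n - A"
  have X: "?X \<in> carrier_mat n n" and uw: "u * w \<in> carrier_mat n n"
    using A u w by auto
  have "?X * (u * w) = (?X * u) * w"
    using X u w by simp
  also have "?X * u = (x - \<kappa>) \<cdot>\<^sub>m u"
    using A u by (simp add: minus_mult_distrib_mat[of _ n n] mult_smult_assoc_mat[of _ n n] eigen)
      (auto intro!: eq_matI simp: algebra_simps)
  finally have "?X * (u * w) = (x - \<kappa>) \<cdot>\<^sub>m (u * w)"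
    using u w by (simp add: mult_smult_assoc_mat[of _ n 1])
  moreover have "?X * ((x - \<kappa>) \<cdot>\<^sub>m 1\<^sub>m n) = (x - \<kappa>) \<cdot>\<^sub>m ?X"
    using mult_smult_distrib[OF X, of "1\<^sub>m n" n] right_mult_one_mat[OF X] by simp
  ultimately have "?X * ((x - \<kappa>) \<cdot>\<^sub>m 1\<^sub>m n + u * w) = (x - \<kappa>) \<cdot>\<^sub>m ?X + (x - \<kappa>) \<cdot>\<^sub>m (u * w)"
    using mult_add_distrib_mat[OF X _ uw, of "(x - \<kappa>) \<cdot>\<^sub>m 1\<^sub>m n"] by simp
  also have "\<dots> = (x - \<kappa>) \<cdot>\<^sub>m (x \<cdot>\<^sub>m 1\<^sub>m n - (A - u * w))"
    using A u w by (intro eq_matI) (auto simp: algebra_simps)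
  finally show ?thesis .
qed

text \<open>Brauer's theorem on rank-one perturbations: only the eigenvalue \<open>\<kappa>\<close> moves.\<close>

lemma char_poly_rank_one_shift:
  fixes A u w :: "complex mat"
  assumes A: "A \<in> carrier_mat n n" and u: "u \<in> carrier_mat n 1" and w: "w \<in> carrier_mat 1 n"
    and eigen: "A * u = \<kappa> \<cdot>\<^sub>m u" and pairing: "w * u = \<mu> \<cdot>\<^sub>m 1\<^sub>m 1"
  shows "[:- \<kappa>, 1:] * char_poly (A - u * w) = [:\<mu> - \<kappa>, 1:] * char_poly A"
proof -
  have "(x - \<kappa>) ^ n * ((x - \<kappa>) * poly (char_poly (A - u * w)) x)
      = (x - \<kappa>) ^ n * ((x - \<kappa> + \<mu>) * poly (char_poly A) x)" for x
  proof -
    let ?X = "x \<cdot>\<^sub>m 1\<^sub>m n - A" and ?Y = "(x - \<kappa>) \<cdot>\<^sub>m 1\<^sub>m n + u * w"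
    have X: "?X \<in> carrier_mat n n" and uw: "u * w \<in> carrier_mat n n" and Y: "?Y \<in> carrier_mat n n"
      using A u w by auto
    have det_XY: "det ?X * det ?Y = (x - \<kappa>) ^ n * poly (char_poly (A - u * w)) x"
      using w rank_one_shift_factorization[OF A u w eigen, of x]
      by (simp add: poly_char_poly_eq_det[OF minus_carrier_mat[OF uw]] flip: det_mult[OF X Y])
    have "(x - \<kappa>) ^ n * ((x - \<kappa>) * poly (char_poly (A - u * w)) x) = det ?X * ((x - \<kappa>) * det ?Y)"
      by (simp only: mult.left_commute det_XY)
    also have "\<dots> = (x - \<kappa>) ^ n * ((x - \<kappa> + \<mu>) * poly (char_poly A) x)"
      unfolding det_smult_one_add_rank_one[OF u w pairing] poly_char_poly_eq_det[OF A]
      by (simp only: mult.commute mult.left_commute)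
    finally show ?thesis .
  qed
  then have "[:- \<kappa>, 1:] ^ n * ([:- \<kappa>, 1:] * char_poly (A - u * w))
      = [:- \<kappa>, 1:] ^ n * ([:\<mu> - \<kappa>, 1:] * char_poly A)"
    by (simp add: poly_eq_poly_eq_iff[symmetric] fun_eq_iff algebra_simps)
  then show ?thesis
    by simp
qed

lemma det_linear_combination_eq_prod:
  fixes A :: "complex mat"
  assumes A: "A \<in> carrier_mat n n"
  shows "det (\<alpha> \<cdot>\<^sub>m 1\<^sub>m n + \<beta> \<cdot>\<^sub>m A) = (\<Prod>e\<in>#proots (char_poly A). \<alpha> + \<beta> * e)"
proof -
  let ?E = "proots (char_poly A)"
  have size: "size ?E = n"
    using degree_monic_char_poly[OF A] by (simp add: size_proots_complex)
  show ?thesis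
  proof (cases "\<beta> = 0")
    case True
    then have "\<alpha> \<cdot>\<^sub>m 1\<^sub>m n + \<beta> \<cdot>\<^sub>m A = \<alpha> \<cdot>\<^sub>m 1\<^sub>m n"
      using A by (intro eq_matI) auto
    then show ?thesis
      using True size by (simp add: image_mset_const_eq)
  next
    case False
    have "\<alpha> \<cdot>\<^sub>m 1\<^sub>m n + \<beta> \<cdot>\<^sub>m A = (- \<beta>) \<cdot>\<^sub>m ((- \<alpha> / \<beta>) \<cdot>\<^sub>m 1\<^sub>m n - A)"
      using A False by (intro eq_matI) (auto simp: algebra_simps)
    then have "det (\<alpha> \<cdot>\<^sub>m 1\<^sub>m n + \<beta> \<cdot>\<^sub>m A) = (- \<beta>) ^ size ?E * poly (char_poly A) (- \<alpha> / \<beta>)"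
      using A by (simp add: poly_char_poly_eq_det[OF A] size)
    also have "\<dots> = (\<Prod>e\<in>#?E. - \<beta>) * (\<Prod>e\<in>#?E. - \<alpha> / \<beta> - e)"
      by (simp add: poly_char_poly_eq_prod_proots[OF A] image_mset_const_eq)
    also have "\<dots> = (\<Prod>e\<in>#?E. \<alpha> + \<beta> * e)"
      unfolding prod_mset.distrib[symmetric]
      using False by (intro arg_cong[of _ _ prod_mset] image_mset_cong) (simp add: field_simps)
    finally show ?thesis .
  qed
qed

lemma proots_char_poly_resolvent:
  fixes A G :: "complex mat"
  assumes A: "A \<in> carrier_mat n n" and G: "G \<in> carrier_mat n n"
    and inv: "(c \<cdot>\<^sub>m 1\<^sub>m n - A) * G = 1\<^sub>m n"
  shows "proots (char_poly G) = image_mset (\<lambda>e. 1 / (c - e)) (proots (char_poly A))"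
proof -
  let ?M = "c \<cdot>\<^sub>m 1\<^sub>m n - A" and ?E = "proots (char_poly A)"
  have M: "?M \<in> carrier_mat n n"
    using A by auto
  have detM: "det ?M = (\<Prod>e\<in>#?E. c - e)"
    using poly_char_poly_eq_prod_proots[OF A, of c] by (simp only: poly_char_poly_eq_det[OF A])
  have "det ?M * det G = 1"
    using inv by (simp flip: det_mult[OF M G])
  then have detM_nonzero: "det ?M \<noteq> 0"
    by auto
  then have c_minus_nonzero: "c - e \<noteq> 0" if "e \<in># ?E" for e
    using that unfolding detM by (auto simp: prod_mset_zero_iff)
  have "det ?M * poly (char_poly G) x = det ?M * (\<Prod>e\<in>#?E. x - 1 / (c - e))" for x
  proof -
    have "?M * (x \<cdot>\<^sub>m 1\<^sub>m n - G) = x \<cdot>\<^sub>m ?M - 1\<^sub>m n"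
      using M G inv mult_minus_distrib_mat[OF M, of "x \<cdot>\<^sub>m 1\<^sub>m n" n G]
      using mult_smult_distrib[OF M, of "1\<^sub>m n" n x] right_mult_one_mat[OF M] by simp
    also have "\<dots> = (x * c - 1) \<cdot>\<^sub>m 1\<^sub>m n + (- x) \<cdot>\<^sub>m A"
      using A by (intro eq_matI) (auto simp: algebra_simps)
    finally have "det ?M * det (x \<cdot>\<^sub>m 1\<^sub>m n - G) = (\<Prod>e\<in>#?E. x * c - 1 + (- x) * e)"
      using G by (simp add: det_linear_combination_eq_prod[OF A]
          flip: det_mult[OF M minus_carrier_mat[OF G]])
    also have "\<dots> = (\<Prod>e\<in>#?E. (c - e) * (x - 1 / (c - e)))"
      using c_minus_nonzero
      by (intro arg_cong[of _ _ prod_mset] image_mset_cong) (simp add: field_simps)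
    finally show ?thesis
      by (simp add: poly_char_poly_eq_det[OF G] detM prod_mset.distrib)
  qed
  then have "poly (char_poly G) x = (\<Prod>e\<in>#image_mset (\<lambda>e. 1 / (c - e)) ?E. x - e)" for x
    using detM_nonzero by (simp add: image_mset.compositionality o_def)
  then show ?thesis
    by (rule proots_eqI)
qed

section \<open>Kemeny's constant\<close>

lemma sum_mset_image_eq_sum_count:
  fixes f :: "'a \<Rightarrow> 'b :: semiring_1"
  assumes "finite S" "set_mset M \<subseteq> S"
  shows "(\<Sum>x\<in>#M. f x) = (\<Sum>x\<in>S. of_nat (count M x) * f x)"
  using assms(2)
proof (induction M)
  case (add y M)
  have "(\<Sum>x\<in>S. of_nat (count (add_mset y M) x) * f x)
      = (\<Sum>x\<in>S. (if x = y then f x else 0) + of_nat (count M x) * f x)"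
    by (intro sum.cong) (auto simp: algebra_simps)
  also have "\<dots> = f y + (\<Sum>x\<in>S. of_nat (count M x) * f x)"
    using add.prems assms(1) by (simp add: sum.distrib)
  finally show ?case
    using add by simp
qed simp

text \<open>The eigenvalue \<open>1\<close> contributes \<open>1 / 0 = 0\<close>.\<close>

lemma kemeny_eq_sum_proots:
  assumes P: "P \<in> carrier_mat n n"
  shows "kemeny P = (\<Sum>\<rho>\<in>#proots (char_poly P). 1 / (1 - \<rho>))"
proof -
  let ?R = "{\<rho>. poly (char_poly P) \<rho> = 0}"
  have nonzero: "char_poly P \<noteq> 0"
    by (rule char_poly_nonzero[OF P])
  have "(\<Sum>\<rho>\<in>#proots (char_poly P). 1 / (1 - \<rho>))
      = (\<Sum>\<rho>\<in>?R. of_nat (Polynomial.order \<rho> (char_poly P)) * (1 / (1 - \<rho>)))"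
    using nonzero by (subst sum_mset_image_eq_sum_count[of ?R]) (simp_all add: poly_roots_finite)
  also have "\<dots> = kemeny P"
    unfolding kemeny_def using poly_roots_finite[OF nonzero]
    by (intro sum.mono_neutral_cong_right) auto
  finally show ?thesis ..
qed

lemma kemeny_mult_commute:
  assumes "A \<in> carrier_mat n m" "B \<in> carrier_mat m n"
  shows "kemeny (A * B) + of_nat m = kemeny (B * A) + of_nat n"
  using arg_cong[OF proots_char_poly_mult_commute[OF assms], of "\<lambda>M. \<Sum>\<rho>\<in>#M. 1 / (1 - \<rho>)"] assms
  by (simp add: kemeny_eq_sum_proots[of _ n] kemeny_eq_sum_proots[of _ m])

lemma kemeny_eq_mat_trace_fundamental_matrix:
  fixes P u w G :: "complex mat"
  assumes P: "P \<in> carrier_mat n n" and u: "u \<in> carrier_mat n 1" and w: "w \<in> carrier_mat 1 n"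
    and G: "G \<in> carrier_mat n n"
    and fixed: "P * u = u" and normalized: "w * u = 1\<^sub>m 1"
    and inv: "(1\<^sub>m n - P + u * w) * G = 1\<^sub>m n"
  shows "kemeny P = mat_trace G - 1"
proof -
  let ?D = "P - u * w"
  have D: "?D \<in> carrier_mat n n"
    using u w by auto
  have "[:- 1, 1:] * char_poly ?D = [:0, 1:] * char_poly P"
    using char_poly_rank_one_shift[OF P u w, of 1 1] fixed normalized
    by (simp add: smult_one_mat del: mult_pCons_left)
  from arg_cong[OF this, of proots]
  have roots: "add_mset 1 (proots (char_poly ?D)) = add_mset 0 (proots (char_poly P))"
    using char_poly_nonzero[OF P] char_poly_nonzero[OF D]
    by (simp add: proots_mult del: mult_pCons_left)
  have "1 \<cdot>\<^sub>m 1\<^sub>m n - ?D = 1\<^sub>m n - P + u * w"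
    using P u w by (intro eq_matI) auto
  then have "mat_trace G = (\<Sum>\<rho>\<in>#proots (char_poly ?D). 1 / (1 - \<rho>))"
    using inv proots_char_poly_resolvent[OF D G, of 1]
    by (simp add: mat_trace_eq_sum_proots[OF G])
  also have "\<dots> = (\<Sum>\<rho>\<in>#add_mset 1 (proots (char_poly ?D)). 1 / (1 - \<rho>))"
    by simp
  also have "\<dots> = 1 + kemeny P"
    unfolding roots by (simp add: kemeny_eq_sum_proots[OF P])
  finally show ?thesis
    by simp
qed

section \<open>Random walks on vertices and on arcs\<close>

definition indexed_mat :: "'a list \<Rightarrow> 'b list \<Rightarrow> ('a \<Rightarrow> 'b \<Rightarrow> 'c) \<Rightarrow> 'c mat" where
  "indexed_mat xs ys f = mat (length xs) (length ys) (\<lambda>(i, j). f (xs ! i) (ys ! j))"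

lemma indexed_mat_carrier [simp]: "indexed_mat xs ys f \<in> carrier_mat (length xs) (length ys)"
  by (simp add: indexed_mat_def)

lemma indexed_mat_cong:
  assumes "\<And>x y. x \<in> set xs \<Longrightarrow> y \<in> set ys \<Longrightarrow> f x y = g x y"
  shows "indexed_mat xs ys f = indexed_mat xs ys g"
  using assms by (auto simp: indexed_mat_def intro!: eq_matI)

lemma sum_nth_distinct:
  assumes "distinct xs"
  shows "(\<Sum>i<length xs. f (xs ! i)) = (\<Sum>x\<in>set xs. f x)"
  using assms by (intro sum.reindex_bij_betw bij_betw_nth) auto

lemma indexed_mat_mult:
  fixes f :: "'a \<Rightarrow> 'b \<Rightarrow> 'd :: semiring_0"
  assumes "distinct ys"
  shows "indexed_mat xs ys f * indexed_mat ys zs g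
    = indexed_mat xs zs (\<lambda>x z. \<Sum>y\<in>set ys. f x y * g y z)"
  by (intro eq_matI)
    (auto simp: indexed_mat_def scalar_prod_def atLeast0LessThan
      simp flip: sum_nth_distinct[OF assms])

lemma one_mat_eq_indexed_mat:
  assumes "distinct xs"
  shows "1\<^sub>m (length xs) = indexed_mat xs xs (\<lambda>x y. of_bool (x = y))"
  using assms by (intro eq_matI) (auto simp: indexed_mat_def nth_eq_iff_index_eq)

lemma mat_trace_indexed_mat:
  assumes "distinct xs"
  shows "mat_trace (indexed_mat xs xs f) = (\<Sum>x\<in>set xs. f x x)"
  by (simp add: mat_trace_def indexed_mat_def flip: sum_nth_distinct[OF assms])

lemma kemeny_indexed_mat:
  fixes p g :: "'a \<Rightarrow> 'a \<Rightarrow> real" and \<pi> :: "'a \<Rightarrow> real"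
  assumes xs: "distinct xs"
    and rows: "\<And>x. x \<in> set xs \<Longrightarrow> (\<Sum>y\<in>set xs. p x y) = 1"
    and weights: "(\<Sum>x\<in>set xs. \<pi> x) = 1"
    and inv: "\<And>x z. x \<in> set xs \<Longrightarrow> z \<in> set xs \<Longrightarrow>
      (\<Sum>y\<in>set xs. (of_bool (x = y) - p x y + \<pi> y) * g y z) = of_bool (x = z)"
  shows "kemeny (indexed_mat xs xs (\<lambda>x y. of_real (p x y))) = of_real ((\<Sum>x\<in>set xs. g x x) - 1)"
proof -
  let ?P = "indexed_mat xs xs (\<lambda>x y. complex_of_real (p x y))"
  let ?G = "indexed_mat xs xs (\<lambda>x y. complex_of_real (g x y))"
  let ?u = "indexed_mat xs [()] (\<lambda>_ _. 1 :: complex)"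
  let ?w = "indexed_mat [()] xs (\<lambda>_ y. complex_of_real (\<pi> y))"
  have "kemeny ?P = mat_trace ?G - 1"
  proof (rule kemeny_eq_mat_trace_fundamental_matrix)
    show "?P * ?u = ?u"
      unfolding indexed_mat_mult[OF xs]
      by (intro indexed_mat_cong) (simp add: rows flip: of_real_sum)
    show "?w * ?u = 1\<^sub>m 1"
      by (intro eq_matI) (auto simp: indexed_mat_mult[OF xs] weights simp flip: of_real_sum,
          simp_all add: indexed_mat_def)
    have sum_eq: "1\<^sub>m (length xs) - ?P + ?u * ?w
        = indexed_mat xs xs (\<lambda>x y. complex_of_real (of_bool (x = y) - p x y + \<pi> y))"
      by (intro eq_matI) (auto simp: one_mat_eq_indexed_mat[OF xs] indexed_mat_mult,
          auto simp: indexed_mat_def)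
    have "(1\<^sub>m (length xs) - ?P + ?u * ?w) * ?G = indexed_mat xs xs
        (\<lambda>x z. complex_of_real (\<Sum>y\<in>set xs. (of_bool (x = y) - p x y + \<pi> y) * g y z))"
      unfolding sum_eq by (simp add: indexed_mat_mult[OF xs])
    also have "\<dots> = indexed_mat xs xs (\<lambda>x z. of_bool (x = z))"
      by (intro indexed_mat_cong) (simp only: inv, simp)
    finally show "(1\<^sub>m (length xs) - ?P + ?u * ?w) * ?G = 1\<^sub>m (length xs)"
      by (simp only: one_mat_eq_indexed_mat[OF xs])
  qed (use indexed_mat_carrier[of _ "[()]"] indexed_mat_carrier[of "[()]"] in auto)
  then show ?thesis
    by (simp add: mat_trace_indexed_mat[OF xs])
qed

definition walk_matrix :: "('a :: linorder \<Rightarrow> 'a \<Rightarrow> bool) \<Rightarrow> 'a set \<Rightarrow> complex mat" where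
  "walk_matrix adj V = (let vs = sorted_list_of_set V in
     indexed_mat vs vs (\<lambda>u v. of_bool (adj u v) / of_nat (gdeg adj V u)))"

lemma arcs_eq_Sigma: "arcs adj V = Sigma V (\<lambda>u. {w \<in> V. adj u w})"
  by (auto simp: arcs_def)

lemma finite_arcs [simp]: "finite V \<Longrightarrow> finite (arcs adj V)"
  by (auto simp: arcs_eq_Sigma)

lemma card_arcs: "finite V \<Longrightarrow> card (arcs adj V) = (\<Sum>v\<in>V. gdeg adj V v)"
  by (simp add: arcs_eq_Sigma gdeg_def)

lemma sum_arcs:
  assumes "finite V"
  shows "(\<Sum>e\<in>arcs adj V. F (fst e) (snd e)) = (\<Sum>u\<in>V. \<Sum>v | v \<in> V \<and> adj u v. F u v)"
  unfolding arcs_eq_Sigma using assms by (subst sum.Sigma) (auto intro: sum.cong)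

lemma sum_arcs_image:
  assumes "finite V" "inj_on f V"
  shows "(\<Sum>e\<in>map_prod f f ` arcs adj V. F (fst e) (snd e))
    = (\<Sum>u\<in>V. \<Sum>v | v \<in> V \<and> adj u v. F (f u) (f v))"
proof -
  have "inj_on (map_prod f f) (arcs adj V)"
    using map_prod_inj_on[OF assms(2,2)] by (rule inj_on_subset) (auto simp: arcs_def)
  then show ?thesis
    using sum_arcs[OF assms(1), where F = "\<lambda>u v. F (f u) (f v)"] by (simp add: sum.reindex)
qed

text \<open>The arc walk factors through the vertices: go to the head of the arc, then choose an arc
  with that tail. Composing the two factors in the opposite order gives the vertex walk.\<close>

lemma edge_kemeny_eq_kemeny_walk_matrix:
  fixes V :: "'a :: linorder set"
  assumes fin: "finite V"
  shows "edge_kemeny adj V + of_nat (card V)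
    = kemeny (walk_matrix adj V) + of_nat (card (arcs adj V))"
proof -
  define vs where "vs = sorted_list_of_set V"
  define es where "es = sorted_list_of_set (arcs adj V)"
  have vs: "set vs = V" "distinct vs" "length vs = card V"
    and es: "set es = arcs adj V" "distinct es" "length es = card (arcs adj V)"
    using fin by (simp_all add: vs_def es_def)
  let ?head = "indexed_mat es vs (\<lambda>e v. of_bool (snd e = v) :: complex)"
  let ?choose = "indexed_mat vs es (\<lambda>v e. of_bool (v = fst e) / of_nat (gdeg adj V v) :: complex)"
  have "?head * ?choose
      = indexed_mat es es (\<lambda>e f. of_bool (snd e = fst f) / of_nat (gdeg adj V (snd e)))"
    unfolding indexed_mat_mult[OF vs(2)] vs(1)
    using fin
    by (intro indexed_mat_cong) (auto simp: es(1) arcs_def simp del: times_divide_eq_right)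
  also have "\<dots> = arc_walk_matrix adj V"
    by (auto simp: arc_walk_matrix_def indexed_mat_def Let_def simp flip: es_def intro!: eq_matI)
  finally have head_choose: "?head * ?choose = arc_walk_matrix adj V" .
  have "(\<Sum>e\<in>arcs adj V. of_bool (u = fst e) / of_nat (gdeg adj V u) * of_bool (snd e = v))
      = (of_bool (adj u v) / of_nat (gdeg adj V u) :: complex)" if "u \<in> V" "v \<in> V" for u v
  proof -
    have "(\<Sum>e\<in>arcs adj V. of_bool (u = fst e) / of_nat (gdeg adj V u) * of_bool (snd e = v))
        = (\<Sum>e\<in>arcs adj V. if e = (u, v) then 1 / of_nat (gdeg adj V u) else 0 :: complex)"
      by (intro sum.cong) auto
    also have "\<dots> = of_bool (adj u v) / of_nat (gdeg adj V u)"
      using that by (simp add: fin) (auto simp: arcs_def)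
    finally show ?thesis .
  qed
  then have "?choose * ?head = walk_matrix adj V"
    unfolding indexed_mat_mult[OF es(2)] walk_matrix_def Let_def vs_def[symmetric]
    by (intro indexed_mat_cong) (simp add: vs(1) es(1))
  then show ?thesis
    using kemeny_mult_commute[of ?head _ _ ?choose, OF indexed_mat_carrier indexed_mat_carrier]
    by (simp add: edge_kemeny_def head_choose vs(3) es(3))
qed

section \<open>Kemeny's constant from effective resistances\<close>

definition laplacian :: "('a \<Rightarrow> 'a \<Rightarrow> bool) \<Rightarrow> 'a set \<Rightarrow> ('a \<Rightarrow> real) \<Rightarrow> 'a \<Rightarrow> real" where
  "laplacian adj V f v = (\<Sum>w | w \<in> V \<and> adj v w. f v - f w)"

lemma laplacian_const [simp]: "laplacian adj V (\<lambda>_. c) v = 0"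
  by (simp add: laplacian_def)

lemma laplacian_add:
  "laplacian adj V (\<lambda>u. f u + g u) v = laplacian adj V f v + laplacian adj V g v"
  by (simp add: laplacian_def algebra_simps flip: sum.distrib)

lemma laplacian_diff:
  "laplacian adj V (\<lambda>u. f u - g u) v = laplacian adj V f v - laplacian adj V g v"
  by (simp add: laplacian_def algebra_simps flip: sum_subtractf)

lemma laplacian_mult_left: "laplacian adj V (\<lambda>u. c * f u) v = c * laplacian adj V f v"
  by (simp add: laplacian_def sum_distrib_left algebra_simps)

lemma laplacian_divide: "laplacian adj V (\<lambda>u. f u / c) v = laplacian adj V f v / c"
  using laplacian_mult_left[of adj V "1 / c"] by simp

lemma laplacian_sum: "laplacian adj V (\<lambda>u. \<Sum>i\<in>I. f i u) v = (\<Sum>i\<in>I. laplacian adj V (f i) v)"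
  unfolding laplacian_def sum_subtractf[symmetric] by (rule sum.swap)

text \<open>For the matrix \<open>R\<close> of effective resistances and the graph Laplacian \<open>L\<close>, the matrix
  \<open>L R + 2 1\<close> has constant rows; the entry \<open>\<kappa> v\<close> is twice the resistance curvature
  at \<open>v\<close>.\<close>

definition is_resistance ::
    "('a \<Rightarrow> 'a \<Rightarrow> bool) \<Rightarrow> 'a set \<Rightarrow> ('a \<Rightarrow> 'a \<Rightarrow> real) \<Rightarrow> ('a \<Rightarrow> real) \<Rightarrow> bool" where
  "is_resistance adj V R \<kappa> \<longleftrightarrow> (\<forall>v\<in>V. R v v = 0) \<and>
     (\<forall>v\<in>V. \<forall>x\<in>V. laplacian adj V (\<lambda>u. R u x) v = \<kappa> v - 2 * of_bool (v = x))"

lemma laplacian_resistance_add_const: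
  assumes "is_resistance adj V R \<kappa>" "i \<in> V" "q \<in> V" "\<And>j. j \<in> V \<Longrightarrow> f j = R j q + C"
  shows "laplacian adj V f i = \<kappa> i - 2 * of_bool (i = q)"
proof -
  have "laplacian adj V f i = laplacian adj V (\<lambda>j. R j q) i"
    using assms(2,4) by (auto simp: laplacian_def intro!: sum.cong)
  then show ?thesis
    using assms(1-3) by (simp add: is_resistance_def)
qed

locale resistance_graph =
  fixes adj :: "'a :: linorder \<Rightarrow> 'a \<Rightarrow> bool" and V :: "'a set"
    and R :: "'a \<Rightarrow> 'a \<Rightarrow> real" and \<kappa> :: "'a \<Rightarrow> real"
  assumes finite_vertices: "finite V" and vertices_nonempty: "V \<noteq> {}"
    and degree_pos: "\<And>v. v \<in> V \<Longrightarrow> gdeg adj V v > 0"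
    and resistance: "is_resistance adj V R \<kappa>"
begin

abbreviation deg :: "'a \<Rightarrow> real" where
  "deg v \<equiv> real (gdeg adj V v)"

definition volume :: real where
  "volume = (\<Sum>v\<in>V. deg v)"

definition stationary :: "'a \<Rightarrow> real" where
  "stationary v = deg v / volume"

definition mean_resistance_from :: "'a \<Rightarrow> real" where
  "mean_resistance_from u = (\<Sum>v\<in>V. stationary v * R u v)"

definition mean_resistance_to :: "'a \<Rightarrow> real" where
  "mean_resistance_to v = (\<Sum>u\<in>V. stationary u * R u v)"

definition mean_resistance :: real where
  "mean_resistance = (\<Sum>u\<in>V. stationary u * mean_resistance_from u)"

definition fundamental :: "'a \<Rightarrow> 'a \<Rightarrow> real" where
  "fundamental u v = deg v *
     (mean_resistance_from u - R u v + mean_resistance_to v - mean_resistance) / 2 + stationary v"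

lemma volume_pos: "volume > 0"
  unfolding volume_def using finite_vertices vertices_nonempty degree_pos by (intro sum_pos) auto

lemma sum_stationary: "(\<Sum>v\<in>V. stationary v) = 1"
  using volume_pos by (simp add: stationary_def volume_def flip: sum_divide_distrib)

lemma laplacian_resistance:
  "v \<in> V \<Longrightarrow> x \<in> V \<Longrightarrow> laplacian adj V (\<lambda>u. R u x) v = \<kappa> v - 2 * of_bool (v = x)"
  using resistance by (simp add: is_resistance_def)

lemma laplacian_mean_resistance_from:
  assumes v: "v \<in> V"
  shows "laplacian adj V mean_resistance_from v = \<kappa> v - 2 * stationary v"
proof -
  have "laplacian adj V mean_resistance_from v
      = (\<Sum>x\<in>V. stationary x * laplacian adj V (\<lambda>u. R u x) v)"
    unfolding mean_resistance_from_def by (simp add: laplacian_sum laplacian_mult_left)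
  also have "\<dots> = (\<Sum>x\<in>V. stationary x * \<kappa> v - 2 * (if x = v then stationary x else 0))"
    using v by (intro sum.cong) (auto simp: laplacian_resistance algebra_simps)
  also have "\<dots> = \<kappa> v - 2 * stationary v"
    using v finite_vertices
    by (simp add: sum_subtractf sum_stationary flip: sum_distrib_right sum_distrib_left)
  finally show ?thesis .
qed

lemma laplacian_fundamental:
  assumes "u \<in> V" "v \<in> V"
  shows "laplacian adj V (\<lambda>w. fundamental w v) u = deg u * (of_bool (u = v) - stationary v)"
  using assms volume_pos
  by (simp add: fundamental_def laplacian_add laplacian_diff laplacian_mult_left laplacian_divide
      laplacian_mean_resistance_from laplacian_resistance)
    (auto simp: stationary_def field_simps)

lemma sum_stationary_fundamental: "(\<Sum>u\<in>V. stationary u * fundamental u v) = stationary v"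
proof -
  have "(\<Sum>u\<in>V. stationary u * fundamental u v)
      = (\<Sum>u\<in>V. deg v * (stationary u * mean_resistance_from u - stationary u * R u v) / 2
          + stationary u * (deg v * (mean_resistance_to v - mean_resistance) / 2 + stationary v))"
    by (intro sum.cong) (auto simp: fundamental_def field_simps)
  also have "\<dots> = deg v * (mean_resistance - mean_resistance_to v) / 2
      + (deg v * (mean_resistance_to v - mean_resistance) / 2 + stationary v)"
    by (simp add: sum.distrib sum_subtractf sum_stationary
        mean_resistance_to_def mean_resistance_def
        flip: sum_distrib_left sum_distrib_right sum_divide_distrib)
  finally show ?thesis
    by (simp add: field_simps)
qed

lemma walk_average:
  assumes "v \<in> V"
  shows "(\<Sum>w\<in>V. of_bool (adj v w) * h w / deg v) = h v - laplacian adj V h v / deg v"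
proof -
  have "(\<Sum>w\<in>V. of_bool (adj v w) * h w / deg v) = (\<Sum>w | w \<in> V \<and> adj v w. h w) / deg v"
    using finite_vertices
    by (auto simp: sum_divide_distrib intro!: sum.mono_neutral_cong_right)
  also have "(\<Sum>w | w \<in> V \<and> adj v w. h w) = deg v * h v - laplacian adj V h v"
    by (simp add: laplacian_def sum_subtractf gdeg_def)
  finally show ?thesis
    using degree_pos[OF assms] by (simp add: diff_divide_distrib)
qed

lemma fundamental_inverse:
  assumes "u \<in> V" "v \<in> V"
  shows "(\<Sum>w\<in>V. (of_bool (u = w) - of_bool (adj u w) / deg u + stationary w) * fundamental w v)
    = of_bool (u = v)"
proof -
  have "(\<Sum>w\<in>V. (of_bool (u = w) - of_bool (adj u w) / deg u + stationary w) * fundamental w v)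
      = (\<Sum>w\<in>V. of_bool (u = w) * fundamental w v)
        - (\<Sum>w\<in>V. of_bool (adj u w) / deg u * fundamental w v)
        + (\<Sum>w\<in>V. stationary w * fundamental w v)"
    by (simp add: distrib_right left_diff_distrib sum.distrib sum_subtractf)
  also have "(\<Sum>w\<in>V. of_bool (u = w) * fundamental w v) = fundamental u v"
    using assms finite_vertices by simp
  finally show ?thesis
    using assms degree_pos[OF assms(1)]
    by (simp add: walk_average laplacian_fundamental sum_stationary_fundamental)
qed

lemma volume_mult_mean_resistance:
  "volume * mean_resistance = (\<Sum>u\<in>V. \<Sum>v\<in>V. deg u * deg v * R u v) / volume"
  using volume_pos
  by (simp add: mean_resistance_def mean_resistance_from_def stationary_def sum_distrib_left
      sum_divide_distrib mult.assoc)

lemma trace_fundamental: "(\<Sum>v\<in>V. fundamental v v) = volume * mean_resistance / 2 + 1"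
proof -
  have "fundamental v v = volume * (stationary v * mean_resistance_from v
      + stationary v * mean_resistance_to v - stationary v * mean_resistance) / 2 + stationary v"
    if "v \<in> V" for v
    using that volume_pos resistance
    by (simp add: fundamental_def stationary_def is_resistance_def field_simps)
  then have "(\<Sum>v\<in>V. fundamental v v) = volume * ((\<Sum>v\<in>V. stationary v * mean_resistance_from v)
      + (\<Sum>v\<in>V. stationary v * mean_resistance_to v) - mean_resistance) / 2 + 1"
    by (simp add: sum.distrib sum_subtractf sum_stationary
        flip: sum_distrib_left sum_distrib_right sum_divide_distrib)
  also have "(\<Sum>v\<in>V. stationary v * mean_resistance_to v) = mean_resistance"
    unfolding mean_resistance_to_def mean_resistance_def mean_resistance_from_def sum_distrib_left
    by (subst sum.swap) (simp add: mult.left_commute)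
  finally show ?thesis
    by (simp add: mean_resistance_def)
qed

lemma kemeny_walk_matrix_eq:
  "kemeny (walk_matrix adj V) = of_real ((\<Sum>u\<in>V. \<Sum>v\<in>V. deg u * deg v * R u v) / (2 * volume))"
proof -
  define vs where "vs = sorted_list_of_set V"
  have vs: "set vs = V" "distinct vs"
    using finite_vertices by (simp_all add: vs_def)
  have "walk_matrix adj V = indexed_mat vs vs (\<lambda>u v. complex_of_real (of_bool (adj u v) / deg u))"
    by (auto simp: walk_matrix_def vs_def Let_def of_bool_def intro!: indexed_mat_cong)
  also have "kemeny \<dots> = of_real ((\<Sum>v\<in>V. fundamental v v) - 1)"
    using kemeny_indexed_mat[OF vs(2), of "\<lambda>u v. of_bool (adj u v) / deg u" stationary fundamental]
      walk_average[of _ "\<lambda>_. 1"] sum_stationary fundamental_inverse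
    by (simp add: vs(1))
  finally show ?thesis
    by (simp add: trace_fundamental volume_mult_mean_resistance mult.commute)
qed

lemma edge_kemeny_eq:
  "edge_kemeny adj V = of_real (volume - real (card V)
     + (\<Sum>u\<in>V. \<Sum>v\<in>V. deg u * deg v * R u v) / (2 * volume))"
proof -
  have "complex_of_real volume = of_nat (card (arcs adj V))"
    using finite_vertices by (simp add: volume_def card_arcs)
  then show ?thesis
    using edge_kemeny_eq_kemeny_walk_matrix[OF finite_vertices, of adj]
    by (simp add: kemeny_walk_matrix_eq algebra_simps)
qed

end

section \<open>Cycles and paths\<close>

definition cycle_adj :: "nat \<Rightarrow> nat \<Rightarrow> nat \<Rightarrow> bool" where
  "cycle_adj l i j \<longleftrightarrow> i < l \<and> j < l \<and> (j = (i + 1) mod l \<or> i = (j + 1) mod l)"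

definition path_adj :: "nat \<Rightarrow> nat \<Rightarrow> nat \<Rightarrow> bool" where
  "path_adj k i j \<longleftrightarrow> i < k \<and> j < k \<and> (j = i + 1 \<or> i = j + 1)"

definition cycle_resistance :: "real \<Rightarrow> real \<Rightarrow> real \<Rightarrow> real" where
  "cycle_resistance l x y = \<bar>x - y\<bar> - (x - y)\<^sup>2 / l"

lemma Suc_mod_eq_if:
  fixes i l :: nat
  assumes "i < l"
  shows "(i + 1) mod l = (if i + 1 = l then 0 else i + 1)"
  using assms by auto

lemma cycle_neighbours:
  assumes "i < l"
  shows "{j. j < l \<and> cycle_adj l i j}
    = {if i + 1 = l then 0 else i + 1, if i = 0 then l - 1 else i - 1}"
proof -
  have "cycle_adj l i j
      \<longleftrightarrow> j = (if i + 1 = l then 0 else i + 1) \<or> i = (if j + 1 = l then 0 else j + 1)"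
    if "j < l" for j
    using assms that unfolding cycle_adj_def by (simp only: Suc_mod_eq_if simp_thms)
  then show ?thesis
    using assms by (auto split: if_splits)
qed

lemma sum_cycle_neighbours:
  assumes "l \<ge> 3" "i < l"
  shows "(\<Sum>j | j < l \<and> cycle_adj l i j. f j)
    = f (if i + 1 = l then 0 else i + 1) + f (if i = 0 then l - 1 else i - 1)"
  unfolding cycle_neighbours[OF assms(2)] using assms by (subst sum.insert) auto

lemma sum_path_neighbours:
  assumes "i < k"
  shows "(\<Sum>j | j < k \<and> path_adj k i j. f j)
    = (if i + 1 < k then f (i + 1) else 0) + (if 0 < i then f (i - 1) else 0)"
proof -
  have "{j. j < k \<and> path_adj k i j}
      = (if i + 1 < k then {i + 1} else {}) \<union> (if 0 < i then {i - 1} else {})"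
    using assms by (auto simp: path_adj_def)
  then show ?thesis
    by (simp add: add.commute)
qed

lemma gdeg_cycle: "l \<ge> 3 \<Longrightarrow> i < l \<Longrightarrow> gdeg (cycle_adj l) {..<l} i = 2"
  using sum_cycle_neighbours[of l i "\<lambda>_. 1 :: nat"] by (simp add: gdeg_def)

lemma gdeg_path:
  assumes "k \<ge> 2" "i < k"
  shows "real (gdeg (path_adj k) {..<k} i) = 2 - of_bool (i = 0) - of_bool (i = k - 1)"
  using sum_path_neighbours[of i k "\<lambda>_. 1 :: real"] assms by (auto simp: gdeg_def)

lemma real_of_nat_trichotomy: "real p = real q \<or> real p + 1 \<le> real q \<or> real q + 1 \<le> real p"
  by (cases p q rule: linorder_cases) auto

lemma abs_diff_second_difference:
  fixes p q :: real
  assumes "p = q \<or> p + 1 \<le> q \<or> q + 1 \<le> p"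
  shows "2 * \<bar>p - q\<bar> - \<bar>p + 1 - q\<bar> - \<bar>p - 1 - q\<bar> = - 2 * of_bool (p = q)"
  using assms by auto

lemma cycle_resistance_second_difference:
  assumes "p = q \<or> p + 1 \<le> q \<or> q + 1 \<le> p" "l > 0"
  shows "2 * cycle_resistance l p q - cycle_resistance l (p + 1) q - cycle_resistance l (p - 1) q
    = 2 / l - 2 * of_bool (p = q)"
proof -
  have "(p - 1 - q)\<^sup>2 / l + (p + 1 - q)\<^sup>2 / l - 2 * ((p - q)\<^sup>2 / l) = 2 / l"
    using assms(2) by (simp add: field_simps power2_eq_square)
  then show ?thesis
    using abs_diff_second_difference[OF assms(1)] unfolding cycle_resistance_def by argo
qed

lemma cycle_resistance_add_period:
  assumes "0 \<le> y - x" "y - x \<le> l" "l > 0"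
  shows "cycle_resistance l (x + l) y = cycle_resistance l x y"
  using assms by (simp add: cycle_resistance_def field_simps power2_eq_square)

lemma cycle_resistance_same [simp]: "cycle_resistance l x x = 0"
  by (simp add: cycle_resistance_def)

lemma cycle_resistance_commute: "cycle_resistance l x y = cycle_resistance l y x"
  by (simp add: cycle_resistance_def abs_minus_commute power2_commute)

lemma is_resistance_cycle:
  assumes l_ge_3: "l \<ge> 3"
  shows "is_resistance (cycle_adj l) {..<l} (\<lambda>i j. cycle_resistance l i j) (\<lambda>_. 2 / l)"
  unfolding is_resistance_def
proof (intro conjI ballI)
  fix i q assume "i \<in> {..<l}" "q \<in> {..<l}"
  then have less: "i < l" "q < l" by auto
  let ?\<rho> = "\<lambda>x. cycle_resistance l x q"
  have "?\<rho> (if i + 1 = l then 0 else i + 1) = ?\<rho> (real i + 1)"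
    using cycle_resistance_add_period[of q 0 l] less by (auto simp: add.commute)
  moreover have "?\<rho> (if i = 0 then l - 1 else i - 1) = ?\<rho> (real i - 1)"
    using cycle_resistance_add_period[of q "- 1" l] less by (auto simp: of_nat_diff)
  ultimately show "laplacian (cycle_adj l) {..<l} (\<lambda>i. ?\<rho> (real i)) i = 2 / l - 2 * of_bool (i = q)"
    using cycle_resistance_second_difference[OF real_of_nat_trichotomy[of i q], of l] l_ge_3 less
    by (simp add: laplacian_def sum_cycle_neighbours)
qed simp

lemma is_resistance_path:
  assumes k_ge_2: "k \<ge> 2"
  shows "is_resistance (path_adj k) {..<k} (\<lambda>i j. \<bar>real i - real j\<bar>)
    (\<lambda>i. of_bool (i = 0) + of_bool (i = k - 1))"
  unfolding is_resistance_def
proof (intro conjI ballI)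
  fix i q assume "i \<in> {..<k}" "q \<in> {..<k}"
  then have less: "i < k" "q < k" by auto
  then have "\<bar>real i + 1 - real q\<bar> = \<bar>real i - real q\<bar> + 1" if "\<not> i + 1 < k"
    using that by auto
  moreover have "\<bar>real i - 1 - real q\<bar> = \<bar>real i - real q\<bar> + 1" if "i = 0"
    using that by auto
  ultimately show "laplacian (path_adj k) {..<k} (\<lambda>i. \<bar>real i - real q\<bar>) i
      = of_bool (i = 0) + of_bool (i = k - 1) - 2 * of_bool (i = q)"
    using abs_diff_second_difference[OF real_of_nat_trichotomy[of i q]] k_ge_2 less
    by (auto simp: laplacian_def sum_path_neighbours of_nat_diff)
qed simp

lemma sum_real_lessThan: "(\<Sum>i<n. real i) = real n * (real n - 1) / 2"
  by (induction n) (auto simp: field_simps)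

lemma sum_real_squares_lessThan:
  "(\<Sum>i<n. (real i)\<^sup>2) = real n * (real n - 1) * (2 * real n - 1) / 6"
  by (induction n) (auto simp: field_simps power2_eq_square)

lemma sum_abs_diff_lessThan:
  assumes "i \<le> n"
  shows "(\<Sum>j<n. \<bar>real i - real j\<bar>)
    = (real i * (real i + 1) + (real n - 1 - real i) * (real n - real i)) / 2"
  using assms
proof (induction rule: dec_induct)
  case base
  have "(\<Sum>j<i. \<bar>real i - real j\<bar>) = (\<Sum>j<i. real i - real j)"
    by (intro sum.cong) auto
  then show ?case
    by (simp add: sum_subtractf sum_real_lessThan field_simps)
next
  case (step n)
  then show ?case
    by (simp add: field_simps)
qed

lemma sum_sum_abs_diff_lessThan:
  "(\<Sum>i<n. \<Sum>j<n. \<bar>real i - real j\<bar>) = real n * ((real n)\<^sup>2 - 1) / 3"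
proof -
  have "(\<Sum>i<n. \<Sum>j<n. \<bar>real i - real j\<bar>)
      = (\<Sum>i<n. (real i)\<^sup>2 + (1 - real n) * real i + real n * (real n - 1) / 2)"
    by (intro sum.cong) (auto simp: sum_abs_diff_lessThan field_simps power2_eq_square)
  also have "\<dots> = real n * ((real n)\<^sup>2 - 1) / 3"
    unfolding sum.distrib sum_distrib_left[symmetric] sum_real_lessThan sum_real_squares_lessThan
    by (simp add: field_simps power2_eq_square)
  finally show ?thesis .
qed

lemma sum_cycle_resistance:
  fixes i l :: nat
  assumes "i < l"
  shows "(\<Sum>j<l. cycle_resistance l i (real j)) = ((real l)\<^sup>2 - 1) / 6"
proof -
  have "(\<Sum>j<l. (real i - real j)\<^sup>2)
      = real l * (real i)\<^sup>2 - 2 * real i * (\<Sum>j<l. real j) + (\<Sum>j<l. (real j)\<^sup>2)"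
    by (simp add: power2_diff sum.distrib sum_subtractf sum_distrib_left mult.assoc)
  then show ?thesis
    using assms
    by (simp add: cycle_resistance_def sum_subtractf sum_abs_diff_lessThan sum_real_lessThan
        sum_real_squares_lessThan flip: sum_divide_distrib)
      (simp add: field_simps power2_eq_square)
qed

text \<open>The hypotheses on \<open>d\<close> and \<open>\<pi>\<close> say that the image under \<open>\<pi>\<close> of the measure with
  weights \<open>d\<close> is twice the counting measure plus point masses.\<close>

lemma sum_weighted_cycle_resistance:
  fixes d :: "'a \<Rightarrow> real" and \<pi> :: "'a \<Rightarrow> nat"
  assumes image: "\<And>f :: nat \<Rightarrow> real. (\<Sum>v\<in>V. d v * f (\<pi> v)) = 2 * (\<Sum>i<l. f i) + w * f 0"
    and l_pos: "l > 0"
  shows "(\<Sum>u\<in>V. \<Sum>v\<in>V. d u * d v * cycle_resistance l (\<pi> u) (\<pi> v))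
    = 2 * ((real l)\<^sup>2 - 1) * (real l + w) / 3"
proof -
  define G where "G i = 2 * (\<Sum>j<l. cycle_resistance l i (real j)) + w * cycle_resistance l i 0"
    for i :: nat
  have row_0: "(\<Sum>j<l. cycle_resistance l 0 (real j)) = ((real l)\<^sup>2 - 1) / 6"
    using sum_cycle_resistance[OF l_pos] by simp
  have G: "G i = ((real l)\<^sup>2 - 1) / 3 + w * cycle_resistance l 0 i" if "i < l" for i
    using sum_cycle_resistance[OF that] cycle_resistance_commute[of l i 0] by (simp add: G_def)
  have "(\<Sum>u\<in>V. \<Sum>v\<in>V. d u * d v * cycle_resistance l (\<pi> u) (\<pi> v)) = (\<Sum>u\<in>V. d u * G (\<pi> u))"
    using image[of "\<lambda>j. cycle_resistance l (real i) (real j)" for i :: nat]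
    by (simp add: G_def mult.assoc flip: sum_distrib_left)
  also have "\<dots> = 2 * (\<Sum>i<l. ((real l)\<^sup>2 - 1) / 3 + w * cycle_resistance l 0 i) + w * G 0"
    unfolding image by (simp add: G)
  also have "\<dots> = 2 * ((real l)\<^sup>2 - 1) * (real l + w) / 3"
    using l_pos unfolding sum.distrib sum_distrib_left[symmetric] row_0 G[OF l_pos]
    by (simp add: field_simps)
  finally show ?thesis .
qed

lemma sum_weighted_path_resistance:
  fixes d :: "'a \<Rightarrow> real" and \<pi> :: "'a \<Rightarrow> nat"
  assumes image: "\<And>f :: nat \<Rightarrow> real.
      (\<Sum>v\<in>V. d v * f (\<pi> v)) = 2 * (\<Sum>i<k. f i) + \<alpha> * f 0 + \<beta> * f (k - 1)"
    and k_pos: "k > 0"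
  shows "(\<Sum>u\<in>V. \<Sum>v\<in>V. d u * d v * \<bar>real (\<pi> u) - real (\<pi> v)\<bar>)
    = 4 * real k * ((real k)\<^sup>2 - 1) / 3 + 2 * (\<alpha> + \<beta>) * real k * (real k - 1)
      + 2 * \<alpha> * \<beta> * (real k - 1)"
proof -
  define G where "G i = 2 * (\<Sum>j<k. \<bar>real i - real j\<bar>) + \<alpha> * real i + \<beta> * \<bar>real i - real (k - 1)\<bar>"
    for i :: nat
  have G_ends: "G 0 = (real k + \<beta>) * (real k - 1)" "G (k - 1) = (real k + \<alpha>) * (real k - 1)"
    unfolding G_def
    by (subst sum_abs_diff_lessThan; use k_pos in \<open>simp add: of_nat_diff field_simps\<close>)+
  have row_end: "(\<Sum>i<k. \<bar>real i - real (k - 1)\<bar>) = real k * (real k - 1) / 2"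
    using sum_abs_diff_lessThan[of "k - 1" k] k_pos by (simp add: abs_minus_commute of_nat_diff)
  have sum_G: "(\<Sum>i<k. G i)
      = 2 * real k * ((real k)\<^sup>2 - 1) / 3 + (\<alpha> + \<beta>) * real k * (real k - 1) / 2"
    unfolding G_def sum.distrib sum_distrib_left[symmetric] sum_sum_abs_diff_lessThan
      sum_real_lessThan row_end
    by (simp add: field_simps)
  have "(\<Sum>u\<in>V. \<Sum>v\<in>V. d u * d v * \<bar>real (\<pi> u) - real (\<pi> v)\<bar>) = (\<Sum>u\<in>V. d u * G (\<pi> u))"
    using image[of "\<lambda>j. \<bar>real i - real j\<bar>" for i :: nat]
    by (simp add: G_def mult.assoc flip: sum_distrib_left)
  also have "\<dots> = 2 * (\<Sum>i<k. G i) + \<alpha> * G 0 + \<beta> * G (k - 1)"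
    by (rule image)
  finally show ?thesis
    unfolding sum_G G_ends by (simp add: field_simps)
qed

section \<open>Cycle barbells\<close>

lemma sum_of_bool_eq_add:
  fixes v c n :: nat
  shows "(\<Sum>i<n. of_bool (v = c + i)) = (of_bool (c \<le> v \<and> v < c + n) :: real)"
proof -
  have "(\<Sum>i<n. of_bool (v = c + i))
      = (\<Sum>i<n. if i = v - c then of_bool (c \<le> v \<and> v < c + n) else 0 :: real)"
    by (intro sum.cong) auto
  then show ?thesis
    by auto
qed

lemma sum_of_bool_mult_diff:
  fixes g :: "nat \<Rightarrow> 'a" and f :: "nat \<Rightarrow> real"
  assumes "q < n"
  shows "(\<Sum>i<n. of_bool (v = g i) * (f i - 2 * of_bool (i = q)))
    = (\<Sum>i<n. f i * of_bool (v = g i)) - 2 * of_bool (v = g q)"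
proof -
  have "(\<Sum>i<n. of_bool (v = g i) * (f i - 2 * of_bool (i = q)))
      = (\<Sum>i<n. f i * of_bool (v = g i) - (if i = q then 2 * of_bool (v = g i) else 0))"
    by (intro sum.cong) auto
  then show ?thesis
    using assms by (simp add: sum_subtractf)
qed

text \<open>For a path with \<open>m\<close> edges, the sum of \<open>deg u * deg v * R u v\<close> is
  \<open>(4 * m ^ 3 + 2 * m) / 3\<close>; closing an end of the path to a cycle of length \<open>l\<close> lowers
  it by \<open>cycle_penalty m l\<close>.\<close>

definition cycle_penalty :: "real \<Rightarrow> real \<Rightarrow> real" where
  "cycle_penalty m l = (8 * m * l\<^sup>2 - 6 * l ^ 3 + 4 * m) / 3"

definition barbell_kemeny :: "real \<Rightarrow> real \<Rightarrow> real \<Rightarrow> real" where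
  "barbell_kemeny m x y
    = m + 1 + ((4 * m ^ 3 + 2 * m) / 3 - cycle_penalty m x - cycle_penalty m y) / (4 * m)"

lemma cycle_penalty_ge_triangle:
  assumes "l \<ge> 3" "m \<ge> l + 1"
  shows "cycle_penalty m 3 \<le> cycle_penalty m l"
proof -
  have "0 \<le> 2 * (l * (l - 3)) + 20 * (l - 3) + 30"
    using assms by (intro add_nonneg_nonneg) auto
  also have "\<dots> = 8 * (l + 1) * (l + 3) - 6 * (l\<^sup>2 + 3 * l + 9)"
    by (simp add: power2_eq_square algebra_simps)
  also have "\<dots> \<le> 8 * m * (l + 3) - 6 * (l\<^sup>2 + 3 * l + 9)"
    using assms by (intro diff_right_mono mult_right_mono) auto
  finally have "0 \<le> (l - 3) * (8 * m * (l + 3) - 6 * (l\<^sup>2 + 3 * l + 9))"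
    using assms by simp
  also have "\<dots> = 3 * (cycle_penalty m l - cycle_penalty m 3)"
    by (simp add: cycle_penalty_def field_simps power2_eq_square power3_eq_cube)
  finally show ?thesis
    by simp
qed

lemma barbell_kemeny_le_triangles:
  assumes "x \<ge> 3" "y \<ge> 3" "m \<ge> x + 1" "m \<ge> y + 1"
  shows "barbell_kemeny m x y \<le> barbell_kemeny m 3 3"
  unfolding barbell_kemeny_def using assms
  by (intro add_left_mono divide_right_mono diff_mono order_refl cycle_penalty_ge_triangle) auto

lemma barbell_kemeny_triangles:
  assumes "x > - 1"
  shows "barbell_kemeny (x + 1) 3 3 = (2 * x ^ 3 + 12 * x\<^sup>2 - 51 * x + 101) / (6 * (x + 1))"
  using assms unfolding barbell_kemeny_def cycle_penalty_def
  by (simp add: divide_simps) (simp add: algebra_simps power2_eq_square power3_eq_cube)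

text \<open>A barbell is covered by three edge-disjoint subgraphs: the first cycle embedded by the
  identity, the path embedded by \<open>cb_pathv a\<close> and the second cycle embedded by translation.\<close>

locale cycle_barbell =
  fixes k a b :: nat
  assumes a_ge_3: "a \<ge> 3" and b_ge_3: "b \<ge> 3" and k_ge_2: "k \<ge> 2"
begin

definition offset :: nat where
  "offset = a + k - 2"

lemma a_le_offset: "a \<le> offset"
  using k_ge_2 by (simp add: offset_def)

lemma cb_pathv_ends [simp]: "cb_pathv a 0 = 0" "cb_pathv a (k - Suc 0) = offset"
  using k_ge_2 by (auto simp: cb_pathv_def offset_def)

lemma inj_cb_pathv: "inj_on (cb_pathv a) {..<k}"
  using a_ge_3 by (auto simp: inj_on_def cb_pathv_def split: if_splits)

lemma cb_verts_eq: "cb_verts k a b = {..<a} \<union> cb_pathv a ` {..<k} \<union> (+) offset ` {..<b}"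
proof (intro equalityI subsetI)
  fix v assume "v \<in> cb_verts k a b"
  then have v_less: "v < offset + b"
    using k_ge_2 by (simp add: cb_verts_def offset_def)
  consider (cycle_a) "v < a" | (path) "a \<le> v" "v < offset" | (cycle_b) "offset \<le> v"
    by linarith
  then show "v \<in> {..<a} \<union> cb_pathv a ` {..<k} \<union> (+) offset ` {..<b}"
  proof cases
    case path
    then have "v = cb_pathv a (v + 1 - a)" "v + 1 - a < k"
      by (auto simp: cb_pathv_def offset_def)
    then show ?thesis
      by blast
  next
    case cycle_b
    then have "v = offset + (v - offset)" "v - offset < b"
      using v_less by auto
    then show ?thesis
      by blast
  qed simp
qed (use k_ge_2 b_ge_3 in \<open>auto simp: cb_verts_def cb_pathv_def offset_def\<close>)

lemma finite_cb_verts [simp]: "finite (cb_verts k a b)"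
  by (simp add: cb_verts_def)

lemma card_cb_verts: "real (card (cb_verts k a b)) = real a + real b + real k - 2"
  using k_ge_2 by (simp add: cb_verts_def of_nat_diff)

lemma cb_adj_iff:
  "cb_adj k a b u v \<longleftrightarrow> cycle_adj a u v
    \<or> (\<exists>i j. path_adj k i j \<and> u = cb_pathv a i \<and> v = cb_pathv a j)
    \<or> (\<exists>i j. cycle_adj b i j \<and> u = offset + i \<and> v = offset + j)"
proof -
  have cycle_adj_iff: "cycle_adj l i j \<longleftrightarrow> i < l \<and> j = (i + 1) mod l \<or> j < l \<and> i = (j + 1) mod l"
    for l i j
    by (auto simp: cycle_adj_def)
  have path_adj_iff: "path_adj k i j \<longleftrightarrow> i + 1 < k \<and> j = i + 1 \<or> j + 1 < k \<and> i = j + 1" for i j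
    by (auto simp: path_adj_def)
  have "cycle_adj a u v
      \<longleftrightarrow> (\<exists>i<a. u = i \<and> v = (i + 1) mod a) \<or> (\<exists>i<a. v = i \<and> u = (i + 1) mod a)"
    by (auto simp: cycle_adj_iff)
  moreover have "(\<exists>i j. path_adj k i j \<and> u = cb_pathv a i \<and> v = cb_pathv a j)
      \<longleftrightarrow> (\<exists>j. j + 1 < k \<and> u = cb_pathv a j \<and> v = cb_pathv a (j + 1))
        \<or> (\<exists>j. j + 1 < k \<and> v = cb_pathv a j \<and> u = cb_pathv a (j + 1))"
    unfolding path_adj_iff by blast
  moreover have "(\<exists>i j. cycle_adj b i j \<and> u = offset + i \<and> v = offset + j)
      \<longleftrightarrow> (\<exists>i<b. u = offset + i \<and> v = offset + (i + 1) mod b)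
        \<or> (\<exists>i<b. v = offset + i \<and> u = offset + (i + 1) mod b)"
    unfolding cycle_adj_iff by blast
  ultimately show ?thesis
    unfolding cb_adj_def cb_edge_def offset_def[symmetric] by (simp only: disj_ac)
qed

definition arcs_a :: "(nat \<times> nat) set" where
  "arcs_a = arcs (cycle_adj a) {..<a}"

definition arcs_path :: "(nat \<times> nat) set" where
  "arcs_path = map_prod (cb_pathv a) (cb_pathv a) ` arcs (path_adj k) {..<k}"

definition arcs_b :: "(nat \<times> nat) set" where
  "arcs_b = map_prod ((+) offset) ((+) offset) ` arcs (cycle_adj b) {..<b}"

lemma finite_arcs_parts: "finite arcs_a" "finite arcs_path" "finite arcs_b"
  by (simp_all add: arcs_a_def arcs_path_def arcs_b_def)

lemma arcs_cb: "arcs (cb_adj k a b) (cb_verts k a b) = arcs_a \<union> arcs_path \<union> arcs_b"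
proof -
  have "(u, v) \<in> arcs (cb_adj k a b) (cb_verts k a b)
      \<longleftrightarrow> (u, v) \<in> arcs_a \<union> arcs_path \<union> arcs_b" for u v
  proof -
    have "(u, v) \<in> arcs_a \<longleftrightarrow> cycle_adj a u v"
      "(u, v) \<in> arcs_path \<longleftrightarrow> (\<exists>i j. path_adj k i j \<and> u = cb_pathv a i \<and> v = cb_pathv a j)"
      "(u, v) \<in> arcs_b \<longleftrightarrow> (\<exists>i j. cycle_adj b i j \<and> u = offset + i \<and> v = offset + j)"
      by (auto simp: arcs_a_def arcs_path_def arcs_b_def arcs_def
          cycle_adj_def path_adj_def image_iff)
    then have "(u, v) \<in> arcs_a \<union> arcs_path \<union> arcs_b \<longleftrightarrow> cb_adj k a b u v"
      by (simp only: Un_iff cb_adj_iff disj_assoc)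
    moreover have "u \<in> cb_verts k a b \<and> v \<in> cb_verts k a b"
      if "(u, v) \<in> arcs_a \<union> arcs_path \<union> arcs_b"
      using that unfolding cb_verts_eq by (auto simp: arcs_a_def arcs_path_def arcs_b_def arcs_def)
    ultimately show ?thesis
      unfolding arcs_def by blast
  qed
  then show ?thesis
    by (intro equalityI subrelI) blast+
qed

lemma arcs_parts_disjoint: "arcs_a \<inter> arcs_path = {}" "(arcs_a \<union> arcs_path) \<inter> arcs_b = {}"
proof -
  have ends_cycle_a: "u < a \<and> v < a" if "(u, v) \<in> arcs_a" for u v
    using that by (simp add: arcs_a_def arcs_def)
  have ends_path: "(a \<le> u \<or> a \<le> v) \<and> (u < offset \<or> v < offset)" if "(u, v) \<in> arcs_path" for u v
    using that a_ge_3
    by (auto simp: arcs_path_def arcs_def path_adj_def cb_pathv_def offset_def split: if_splits)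
  have ends_cycle_b: "offset \<le> u \<and> offset \<le> v" if "(u, v) \<in> arcs_b" for u v
    using that by (auto simp: arcs_b_def)
  have "(u, v) \<notin> arcs_path" if "(u, v) \<in> arcs_a" for u v
    using ends_cycle_a[OF that] ends_path[of u v] by linarith
  then show "arcs_a \<inter> arcs_path = {}"
    by auto
  have "(u, v) \<notin> arcs_b" if "(u, v) \<in> arcs_a \<union> arcs_path" for u v
    using that ends_cycle_a[of u v] ends_path[of u v] ends_cycle_b[of u v] a_le_offset by auto
  then show "(arcs_a \<union> arcs_path) \<inter> arcs_b = {}"
    by auto
qed

lemma sum_arcs_cb:
  fixes F :: "nat \<Rightarrow> nat \<Rightarrow> real"
  shows "(\<Sum>u\<in>cb_verts k a b. \<Sum>v | v \<in> cb_verts k a b \<and> cb_adj k a b u v. F u v)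
    = (\<Sum>i<a. \<Sum>j | j \<in> {..<a} \<and> cycle_adj a i j. F i j)
      + (\<Sum>i<k. \<Sum>j | j \<in> {..<k} \<and> path_adj k i j. F (cb_pathv a i) (cb_pathv a j))
      + (\<Sum>i<b. \<Sum>j | j \<in> {..<b} \<and> cycle_adj b i j. F (offset + i) (offset + j))"
proof -
  let ?F = "\<lambda>e. F (fst e) (snd e)"
  have "(\<Sum>u\<in>cb_verts k a b. \<Sum>v | v \<in> cb_verts k a b \<and> cb_adj k a b u v. F u v)
      = sum ?F (arcs_a \<union> arcs_path \<union> arcs_b)"
    unfolding arcs_cb[symmetric] by (rule sum_arcs[symmetric]) simp
  also have "\<dots> = sum ?F (arcs_a \<union> arcs_path) + sum ?F arcs_b"
    using finite_arcs_parts arcs_parts_disjoint(2) by (intro sum.union_disjoint) auto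
  also have "sum ?F (arcs_a \<union> arcs_path) = sum ?F arcs_a + sum ?F arcs_path"
    using finite_arcs_parts arcs_parts_disjoint(1) by (intro sum.union_disjoint) auto
  also have "sum ?F arcs_a = (\<Sum>i<a. \<Sum>j | j \<in> {..<a} \<and> cycle_adj a i j. F i j)"
    unfolding arcs_a_def by (rule sum_arcs) simp
  also have "sum ?F arcs_path
      = (\<Sum>i<k. \<Sum>j | j \<in> {..<k} \<and> path_adj k i j. F (cb_pathv a i) (cb_pathv a j))"
    unfolding arcs_path_def by (rule sum_arcs_image) (simp_all add: inj_cb_pathv)
  also have "sum ?F arcs_b
      = (\<Sum>i<b. \<Sum>j | j \<in> {..<b} \<and> cycle_adj b i j. F (offset + i) (offset + j))"
    unfolding arcs_b_def by (rule sum_arcs_image) simp_all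
  finally show ?thesis .
qed

lemma laplacian_cb:
  assumes "v \<in> cb_verts k a b"
  shows "laplacian (cb_adj k a b) (cb_verts k a b) h v
    = (\<Sum>i<a. of_bool (v = i) * laplacian (cycle_adj a) {..<a} h i)
      + (\<Sum>i<k. of_bool (v = cb_pathv a i) * laplacian (path_adj k) {..<k} (\<lambda>i. h (cb_pathv a i)) i)
      + (\<Sum>i<b. of_bool (v = offset + i) * laplacian (cycle_adj b) {..<b} (\<lambda>i. h (offset + i)) i)"
proof -
  have "laplacian (cb_adj k a b) (cb_verts k a b) h v
      = (\<Sum>u\<in>cb_verts k a b. of_bool (v = u) * laplacian (cb_adj k a b) (cb_verts k a b) h u)"
    using assms by simp
  then show ?thesis
    unfolding laplacian_def sum_distrib_left sum_arcs_cb .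
qed

lemma sum_gdeg_cb:
  fixes f :: "nat \<Rightarrow> real"
  shows "(\<Sum>v\<in>cb_verts k a b. real (gdeg (cb_adj k a b) (cb_verts k a b) v) * f v)
    = 2 * (\<Sum>i<a. f i) + (2 * (\<Sum>i<k. f (cb_pathv a i)) - f 0 - f offset)
      + 2 * (\<Sum>i<b. f (offset + i))"
proof -
  have degree: "(\<Sum>j | j \<in> V \<and> adj i j. c) = real (gdeg adj V i) * c"
    for adj V and i :: nat and c :: real
    by (simp add: gdeg_def)
  have "(\<Sum>i<k. real (gdeg (path_adj k) {..<k} i) * f (cb_pathv a i))
      = (\<Sum>i<k. 2 * f (cb_pathv a i) - of_bool (i = 0) * f (cb_pathv a i)
          - of_bool (i = k - 1) * f (cb_pathv a i))"
    using k_ge_2 by (intro sum.cong) (auto simp: gdeg_path algebra_simps)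
  also have "\<dots> = 2 * (\<Sum>i<k. f (cb_pathv a i)) - f 0 - f offset"
    using k_ge_2 by (simp add: sum_subtractf sum_distrib_left)
  finally show ?thesis
    using sum_arcs_cb[of "\<lambda>u _. f u", unfolded degree] a_ge_3 b_ge_3
    by (simp add: gdeg_cycle sum_distrib_left)
qed

text \<open>Collapsing the other two subgraphs to the vertices where they are attached retracts the
  barbell onto each of the three subgraphs; effective resistance is the sum of the resistances
  between the images.\<close>

definition retract_a :: "nat \<Rightarrow> nat" where
  "retract_a u = (if u < a then u else 0)"

definition retract_path :: "nat \<Rightarrow> nat" where
  "retract_path u = min (u + 1 - a) (k - 1)"

definition retract_b :: "nat \<Rightarrow> nat" where
  "retract_b u = u - offset"

lemma retract_a_simps [simp]:
  "i < a \<Longrightarrow> retract_a i = i"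
  "retract_a (cb_pathv a i) = 0"
  "retract_a (offset + i) = 0"
  using a_le_offset by (auto simp: retract_a_def cb_pathv_def)

lemma retract_path_simps [simp]:
  "i < a \<Longrightarrow> retract_path i = 0"
  "i < k \<Longrightarrow> retract_path (cb_pathv a i) = i"
  "retract_path (offset + i) = k - 1"
  using a_ge_3 k_ge_2 by (auto simp: retract_path_def cb_pathv_def offset_def)

lemma retract_b_simps [simp]:
  "i < a \<Longrightarrow> retract_b i = 0"
  "i < k \<Longrightarrow> retract_b (cb_pathv a i) = 0"
  "retract_b (offset + i) = i"
  using a_le_offset by (auto simp: retract_b_def cb_pathv_def offset_def)

lemma retract_bounds:
  assumes "x \<in> cb_verts k a b"
  shows "retract_a x < a" "retract_path x < k" "retract_b x < b"
  using assms a_ge_3 b_ge_3 k_ge_2 unfolding cb_verts_eq by auto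

lemma retracts_mset:
  assumes "x \<in> cb_verts k a b"
  shows "{#retract_a x, cb_pathv a (retract_path x), offset + retract_b x#} = {#x, 0, offset#}"
  using assms a_ge_3 unfolding cb_verts_eq by (auto simp: add_mset_commute)

definition barbell_resistance :: "nat \<Rightarrow> nat \<Rightarrow> real" where
  "barbell_resistance u v = cycle_resistance a (retract_a u) (retract_a v)
     + \<bar>real (retract_path u) - real (retract_path v)\<bar>
     + cycle_resistance b (retract_b u) (retract_b v)"

definition curvature :: "nat \<Rightarrow> real" where
  "curvature v = 2 / a * of_bool (v < a) + 2 / b * of_bool (offset \<le> v)
     - of_bool (v = 0) - of_bool (v = offset)"

lemma laplacian_barbell_resistance:
  assumes x: "x \<in> cb_verts k a b"
  defines "h \<equiv> \<lambda>u. barbell_resistance u x"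
  shows "i < a \<Longrightarrow> laplacian (cycle_adj a) {..<a} h i = 2 / a - 2 * of_bool (i = retract_a x)"
    and "i < k \<Longrightarrow> laplacian (path_adj k) {..<k} (\<lambda>i. h (cb_pathv a i)) i
      = of_bool (i = 0) + of_bool (i = k - 1) - 2 * of_bool (i = retract_path x)"
    and "i < b \<Longrightarrow> laplacian (cycle_adj b) {..<b} (\<lambda>i. h (offset + i)) i
      = 2 / b - 2 * of_bool (i = retract_b x)"
proof -
  note bounds = retract_bounds[OF x]
  note h_eq = h_def barbell_resistance_def
  show "laplacian (cycle_adj a) {..<a} h i = 2 / a - 2 * of_bool (i = retract_a x)" if "i < a"
    by (rule laplacian_resistance_add_const[OF is_resistance_cycle[OF a_ge_3], where
          C = "real (retract_path x) + cycle_resistance b 0 (retract_b x)"])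
      (use that bounds in \<open>auto simp: h_eq\<close>)
  show "laplacian (path_adj k) {..<k} (\<lambda>i. h (cb_pathv a i)) i
      = of_bool (i = 0) + of_bool (i = k - 1) - 2 * of_bool (i = retract_path x)" if "i < k"
    by (rule laplacian_resistance_add_const[OF is_resistance_path[OF k_ge_2], where
          C = "cycle_resistance a 0 (retract_a x) + cycle_resistance b 0 (retract_b x)"])
      (use that bounds in \<open>auto simp: h_eq\<close>)
  show "laplacian (cycle_adj b) {..<b} (\<lambda>i. h (offset + i)) i
      = 2 / b - 2 * of_bool (i = retract_b x)" if "i < b"
    by (rule laplacian_resistance_add_const[OF is_resistance_cycle[OF b_ge_3], where
          C = "cycle_resistance a 0 (retract_a x) + (real (k - 1) - real (retract_path x))"])
      (use that bounds in \<open>auto simp: h_eq\<close>)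
qed

lemma sum_retract_indicators:
  assumes "x \<in> cb_verts k a b"
  shows "of_bool (v = retract_a x) + of_bool (v = cb_pathv a (retract_path x))
    + of_bool (v = offset + retract_b x)
    = (of_bool (v = x) + of_bool (v = 0) + of_bool (v = offset) :: real)"
  using arg_cong[OF retracts_mset[OF assms], of "\<lambda>M. \<Sum>y\<in>#M. of_bool (v = y) :: real"]
  by (simp add: add.assoc)

lemma is_resistance_barbell:
  "is_resistance (cb_adj k a b) (cb_verts k a b) barbell_resistance curvature"
  unfolding is_resistance_def
proof (intro conjI ballI)
  fix v x assume v: "v \<in> cb_verts k a b" and x: "x \<in> cb_verts k a b"
  have sum_a: "(\<Sum>i<a. 2 / real a * of_bool (v = i)) = 2 / a * of_bool (v < a)"
    using sum_of_bool_eq_add[of v 0 a] by (simp flip: sum_distrib_left sum_divide_distrib)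
  have sum_path: "(\<Sum>i<k. (of_bool (i = 0) + of_bool (i = k - 1)) * of_bool (v = cb_pathv a i))
      = (of_bool (v = 0) + of_bool (v = offset) :: real)"
    using k_ge_2 by (simp add: distrib_right sum.distrib del: sum_mult_of_bool_eq)
  have "v < offset + b"
    using v k_ge_2 by (simp add: cb_verts_def offset_def)
  then have sum_b: "(\<Sum>i<b. 2 / real b * of_bool (v = offset + i)) = 2 / b * of_bool (offset \<le> v)"
    using sum_of_bool_eq_add[of v offset b] by (simp flip: sum_distrib_left sum_divide_distrib)
  note bounds = retract_bounds[OF x]
  have "laplacian (cb_adj k a b) (cb_verts k a b) (\<lambda>u. barbell_resistance u x) v
      = (\<Sum>i<a. of_bool (v = i) * (2 / real a - 2 * of_bool (i = retract_a x)))
        + (\<Sum>i<k. of_bool (v = cb_pathv a i)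
            * (of_bool (i = 0) + of_bool (i = k - 1) - 2 * of_bool (i = retract_path x)))
        + (\<Sum>i<b. of_bool (v = offset + i) * (2 / real b - 2 * of_bool (i = retract_b x)))"
    unfolding laplacian_cb[OF v]
    by (intro arg_cong2[of _ _ _ _ "(+)"] sum.cong refl)
      (simp_all add: laplacian_barbell_resistance[OF x])
  also have "\<dots> = curvature v + 2 * (of_bool (v = 0) + of_bool (v = offset))
      - 2 * (of_bool (v = retract_a x) + of_bool (v = cb_pathv a (retract_path x))
          + of_bool (v = offset + retract_b x))"
    unfolding sum_of_bool_mult_diff[OF bounds(1)] sum_of_bool_mult_diff[OF bounds(2)]
      sum_of_bool_mult_diff[OF bounds(3)] sum_a sum_path sum_b curvature_def by simp
  finally show "laplacian (cb_adj k a b) (cb_verts k a b) (\<lambda>u. barbell_resistance u x) v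
      = curvature v - 2 * of_bool (v = x)"
    unfolding sum_retract_indicators[OF x] by simp
qed (simp add: barbell_resistance_def)

lemma gdeg_cb_pos:
  assumes "v \<in> cb_verts k a b"
  shows "gdeg (cb_adj k a b) (cb_verts k a b) v > 0"
proof -
  have cycle_arc: "\<exists>j. (i, j) \<in> arcs (cycle_adj l) {..<l}" if "i < l" for i l
    using that by (intro exI[of _ "(i + 1) mod l"]) (simp add: arcs_def cycle_adj_def)
  have path_arc: "\<exists>j. (i, j) \<in> arcs (path_adj k) {..<k}" if "i < k" for i
    using that k_ge_2 by (intro exI[of _ "if i + 1 < k then i + 1 else i - 1"])
      (auto simp: arcs_def path_adj_def)
  consider (cycle_a) "v < a" | (path) i where "i < k" "v = cb_pathv a i"
    | (cycle_b) i where "i < b" "v = offset + i"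
    using assms unfolding cb_verts_eq by auto
  then have "\<exists>w. (v, w) \<in> arcs (cb_adj k a b) (cb_verts k a b)"
  proof cases
    case cycle_a
    then show ?thesis
      using cycle_arc[of v a] unfolding arcs_cb arcs_a_def by blast
  next
    case (path i)
    then show ?thesis
      using path_arc[of i] unfolding arcs_cb arcs_path_def
      by (metis UnI1 UnI2 image_eqI map_prod_simp)
  next
    case (cycle_b i)
    then show ?thesis
      using cycle_arc[of i b] unfolding arcs_cb arcs_b_def by (metis UnI2 image_eqI map_prod_simp)
  qed
  then show ?thesis
    by (auto simp: gdeg_def arcs_def card_gt_0_iff)
qed

sublocale resistance_graph "cb_adj k a b" "cb_verts k a b" barbell_resistance curvature
proof
  show "cb_verts k a b \<noteq> {}"
    using a_ge_3 by (auto simp: cb_verts_eq lessThan_empty_iff)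
qed (simp_all add: gdeg_cb_pos is_resistance_barbell)

definition edge_count :: real where
  "edge_count = real a + real b + real k - 1"

lemma sum_deg_retract_a:
  fixes f :: "nat \<Rightarrow> real"
  shows "(\<Sum>v\<in>cb_verts k a b. deg v * f (retract_a v))
    = 2 * (\<Sum>i<a. f i) + 2 * (edge_count - a) * f 0"
  unfolding sum_gdeg_cb using a_ge_3 retract_a_simps(3)[of 0]
  by simp (simp add: edge_count_def algebra_simps)

lemma sum_deg_retract_b:
  fixes f :: "nat \<Rightarrow> real"
  shows "(\<Sum>v\<in>cb_verts k a b. deg v * f (retract_b v))
    = 2 * (\<Sum>i<b. f i) + 2 * (edge_count - b) * f 0"
  unfolding sum_gdeg_cb using a_ge_3 retract_b_simps(3)[of 0]
  by simp (simp add: edge_count_def algebra_simps)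

lemma sum_deg_retract_path:
  fixes f :: "nat \<Rightarrow> real"
  shows "(\<Sum>v\<in>cb_verts k a b. deg v * f (retract_path v))
    = 2 * (\<Sum>i<k. f i) + (2 * real a - 1) * f 0 + (2 * real b - 1) * f (k - 1)"
  unfolding sum_gdeg_cb using a_ge_3 retract_path_simps(3)[of 0]
  by simp (simp add: algebra_simps)

lemma volume_eq: "volume = 2 * edge_count"
  using sum_deg_retract_a[of "\<lambda>_. 1"] by (simp add: volume_def algebra_simps)

lemma sum_deg_deg_barbell_resistance:
  "(\<Sum>u\<in>cb_verts k a b. \<Sum>v\<in>cb_verts k a b. deg u * deg v * barbell_resistance u v)
    = (4 * edge_count ^ 3 + 2 * edge_count) / 3
      - cycle_penalty edge_count a - cycle_penalty edge_count b"
proof -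
  have "a > 0" "b > 0" "k > 0"
    using a_ge_3 b_ge_3 k_ge_2 by auto
  then show ?thesis
    unfolding barbell_resistance_def distrib_left sum.distrib
      sum_weighted_cycle_resistance[OF sum_deg_retract_a \<open>a > 0\<close>]
      sum_weighted_path_resistance[OF sum_deg_retract_path \<open>k > 0\<close>]
      sum_weighted_cycle_resistance[OF sum_deg_retract_b \<open>b > 0\<close>]
    by (simp add: edge_count_def cycle_penalty_def field_simps power2_eq_square power3_eq_cube)
qed

lemma Ke_CB_eq: "Ke_CB k a b = of_real (barbell_kemeny edge_count a b)"
  unfolding Ke_CB_def edge_kemeny_eq volume_eq card_cb_verts sum_deg_deg_barbell_resistance
  by (simp add: barbell_kemeny_def edge_count_def)

end

theorem theorem5p6:
  fixes n :: nat
  assumes "n \<ge> 6"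
  shows "(\<forall>k a b. a \<ge> 3 \<longrightarrow> b \<ge> 3 \<longrightarrow> k \<ge> 2 \<longrightarrow> a + b + k - 2 = n \<longrightarrow>
            Re (Ke_CB k a b) \<le> Re (Ke_CB (n - 4) 3 3))
       \<and> Ke_CB (n - 4) 3 3 =
           of_real ((2 * real n ^ 3 + 12 * real n ^ 2 - 51 * real n + 101) / (6 * (real n + 1)))"
proof (intro conjI allI impI)
  have Ke_CB: "Ke_CB k a b = of_real (barbell_kemeny (real n + 1) a b)"
    if "a \<ge> 3" "b \<ge> 3" "k \<ge> 2" "a + b + k - 2 = n" for k a b
  proof -
    interpret cycle_barbell k a b
      using that by unfold_locales
    have "edge_count = real n + 1"
      using that by (auto simp: edge_count_def)
    then show ?thesis
      by (simp add: Ke_CB_eq)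
  qed
  have extremal: "Ke_CB (n - 4) 3 3 = of_real (barbell_kemeny (real n + 1) 3 3)"
    using Ke_CB[of 3 3 "n - 4"] assms by simp
  show "Re (Ke_CB k a b) \<le> Re (Ke_CB (n - 4) 3 3)"
    if "a \<ge> 3" "b \<ge> 3" "k \<ge> 2" "a + b + k - 2 = n" for k a b
    unfolding Ke_CB[OF that] extremal Re_complex_of_real
    using that by (intro barbell_kemeny_le_triangles) auto
  show "Ke_CB (n - 4) 3 3 =
      of_real ((2 * real n ^ 3 + 12 * real n ^ 2 - 51 * real n + 101) / (6 * (real n + 1)))"
    unfolding extremal by (simp add: barbell_kemeny_triangles)
qed

end
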